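(* Let the network, weight matrix $W$ and functions $f_1,\dots,f_N$ satisfy assumptions A1, A2, A3 of the context, let $\beta_s>0$, and let $\{\hat{\mathbf x}^s\}\subset\mathbb R^{nN}$ be a sequence such that $$\|\nabla\Phi_{\beta_s}(\hat{\mathbf x}^s)\|_\infty\le\varepsilon_s .$$ If $\lim_{s\to+\infty}\beta_s=\lim_{s\to+\infty}\varepsilon_s=0$, then every accumulation point of $\{\hat{\mathbf x}^s\}$ satisfies the sufficient second order optimality conditions for the problem $$\min_{\mathbf x\in\mathbb R^{nN}}F(\mathbf x)\quad\text{s.t.}\quad(I-\mathcal W)^{1/2}\mathbf x=0 .$$
   Context: Assumptions. A1: $\mathcal G=(\mathcal V,\mathcal E)$ is an undirected, simple, connected graph on nodes $1,\dots,N$, with self-loops at every node ($(i,i)\in\mathcal E$ for all $i$). A2: $W=[w_{ij}]\in\mathbb R^{N\times N}$ is symmetric and doubly stochastic (nonnegative entries, rows and columns sum to 1), $w_{ij}=0$ if $(i,j)\notin\mathcal E$, $w_{ij}\neq0$ if $(i,j)\in\mathcal E$, and $w_{ii}\ne0$ for all $i$. A3: each $f_i:\mathbb R^n\to\mathbb R$ is twice continuously differentiable and strongly convex, and there are constants $0<\mu<M$ and $L>0$ such that for all $i$ and all $y,z\in\mathbb R^n$: $\mu I\prec\nabla^2f_i(y)\prec MI$ (where $A\prec B$ means that $B-A$ is positive definite) and $\|\nabla^2f_i(y)-\nabla^2f_i(z)\|_\infty\le L\|y-z\|_\infty$. For $\mathbf x=(\mathbf x_1,\dots,\mathbf x_N)\in\mathbb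 R^{nN}$, $\mathbf x_i\in\mathbb R^n$, let $F(\mathbf x)=\sum_{i=1}^Nf_i(\mathbf x_i)$, $\mathcal W=W\otimes I_n$, and for $\beta>0$ let $\Phi_\beta(\mathbf x)=F(\mathbf x)+\frac1{2\beta}\mathbf x^\top(I-\mathcal W)\mathbf x$. The matrix $I-\mathcal W$ is symmetric positive semidefinite and $(I-\mathcal W)^{1/2}$ is its positive semidefinite square root. A point $\bar{\mathbf x}$ satisfies the sufficient second order optimality conditions for the constrained problem if it is feasible, $(I-\mathcal W)^{1/2}\bar{\mathbf x}=0$, there is a multiplier $\bar{\mathbf v}\in\mathbb R^{nN}$ with $\nabla F(\bar{\mathbf x})+(I-\mathcal W)^{1/2}\bar{\mathbf v}=0$ (KKT conditions), and the Hessian in $\mathbf x$ of the Lagrangian $\mathcal L(\mathbf x,\mathbf v)=F(\mathbf x)+\mathbf v^\top(I-\mathcal W)^{1/2}\mathbf x$ at $(\bar{\mathbf x},\bar{\mathbf v})$ satisfies $\mathbf u^\top\nabla^2_{\mathbf x\mathbf x}\mathcal L(\bar{\mathbf x},\bar{\mathbf v})\mathbf u>0$ for every nonzero $\mathbf u$ with $(I-\mathcal W)^{1/2}\mathbf u=0$. *)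

theory Defs
  imports "HOL-Analysis.Analysis"
begin

subsection \<open>Matrices\<close>

definition pos_def :: "real^'k^'k \<Rightarrow> bool" where
  "pos_def A \<longleftrightarrow> transpose A = A \<and> (\<forall>x. x \<noteq> 0 \<longrightarrow> 0 < x \<bullet> (A *v x))"

definition pos_semidef :: "real^'k^'k \<Rightarrow> bool" where
  "pos_semidef A \<longleftrightarrow> transpose A = A \<and> (\<forall>x. 0 \<le> x \<bullet> (A *v x))"

text \<open>Meaningful only for positive semidefinite \<open>A\<close>, where exactly one such root exists.\<close>

definition psd_sqrt :: "real^'k^'k \<Rightarrow> real^'k^'k" where
  "psd_sqrt A = (THE B. pos_semidef B \<and> B ** B = A)"

text \<open>The matrix norm induced by the maximum norm \<^const>\<open>infnorm\<close> on vectors, that is, the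
  maximal absolute row sum.\<close>

definition mat_infnorm :: "real^'m^'k \<Rightarrow> real" where
  "mat_infnorm A = (MAX i. \<Sum>j\<in>UNIV. \<bar>A $ i $ j\<bar>)"

definition kronecker :: "real^'v^'v \<Rightarrow> real^'n^'n \<Rightarrow> real^('v \<times> 'n)^('v \<times> 'n)" where
  "kronecker A B = (\<chi> p q. A $ fst p $ fst q * B $ snd p $ snd q)"

subsection \<open>Gradients and Hessians\<close>

definition gradient :: "('a::real_inner \<Rightarrow> real) \<Rightarrow> 'a \<Rightarrow> 'a" where
  "gradient f x = (THE D. GDERIV f x :> D)"

definition hessian :: "(real^'k \<Rightarrow> real) \<Rightarrow> real^'k \<Rightarrow> real^'k^'k" where
  "hessian f x = jacobian (gradient f) (at x)"

definition twice_cont_differentiable :: "(real^'k \<Rightarrow> real) \<Rightarrow> bool" where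
  "twice_cont_differentiable f \<longleftrightarrow>
     (\<forall>x. f differentiable (at x)) \<and> (\<forall>x. gradient f differentiable (at x)) \<and>
     continuous_on UNIV (hessian f)"

definition strongly_convex :: "('a::real_inner \<Rightarrow> real) \<Rightarrow> bool" where
  "strongly_convex f \<longleftrightarrow> (\<exists>m>0. \<forall>x y. \<forall>t\<in>{0..1}.
     f (t *\<^sub>R x + (1 - t) *\<^sub>R y) \<le> t * f x + (1 - t) * f y - m / 2 * t * (1 - t) * (norm (x - y))\<^sup>2)"

subsection \<open>The network problem\<close>

text \<open>The nodes are the elements of the finite type \<open>'v\<close>. The edge relation contains both
  orientations of every undirected edge and, by convention, all self-loops.\<close>

definition connected_network :: "('v::finite \<times> 'v) set \<Rightarrow> bool" where
  "connected_network E \<longleftrightarrow> sym E \<and> (\<forall>i. (i, i) \<in> E) \<and> (\<forall>i j. (i, j) \<in> E\<^sup>*)"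

definition doubly_stochastic :: "real^'v^'v \<Rightarrow> bool" where
  "doubly_stochastic W \<longleftrightarrow> (\<forall>i j. 0 \<le> W $ i $ j) \<and>
     (\<forall>i. (\<Sum>j\<in>UNIV. W $ i $ j) = 1) \<and> (\<forall>j. (\<Sum>i\<in>UNIV. W $ i $ j) = 1)"

definition network_weights :: "('v::finite \<times> 'v) set \<Rightarrow> real^'v^'v \<Rightarrow> bool" where
  "network_weights E W \<longleftrightarrow> transpose W = W \<and> doubly_stochastic W \<and>
     (\<forall>i j. (i, j) \<notin> E \<longrightarrow> W $ i $ j = 0) \<and> (\<forall>i j. (i, j) \<in> E \<longrightarrow> W $ i $ j \<noteq> 0) \<and>
     (\<forall>i. W $ i $ i \<noteq> 0)"

definition regular_objectives :: "real \<Rightarrow> real \<Rightarrow> real \<Rightarrow> ('v::finite \<Rightarrow> real^'n \<Rightarrow> real) \<Rightarrow> bool" where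
  "regular_objectives \<mu> M L f \<longleftrightarrow> (\<forall>i.
     twice_cont_differentiable (f i) \<and> strongly_convex (f i) \<and>
     (\<forall>y. pos_def (hessian (f i) y - \<mu> *\<^sub>R mat 1) \<and> pos_def (M *\<^sub>R mat 1 - hessian (f i) y)) \<and>
     (\<forall>y z. mat_infnorm (hessian (f i) y - hessian (f i) z) \<le> L * infnorm (y - z)))"

text \<open>Vectors stacked from one block per node are indexed by pairs (node, coordinate).\<close>

definition block :: "'v::finite \<Rightarrow> real^('v \<times> 'n) \<Rightarrow> real^'n" where
  "block i x = (\<chi> j. x $ (i, j))"

definition aggregate :: "('v::finite \<Rightarrow> real^'n \<Rightarrow> real) \<Rightarrow> real^('v \<times> 'n) \<Rightarrow> real" where
  "aggregate f x = (\<Sum>i\<in>UNIV. f i (block i x))"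

definition laplacian :: "real^'v^'v \<Rightarrow> real^('v \<times> 'n::finite)^('v \<times> 'n)" where
  "laplacian W = mat 1 - kronecker W (mat 1)"

definition penalty ::
  "('v::finite \<Rightarrow> real^'n \<Rightarrow> real) \<Rightarrow> real^'v^'v \<Rightarrow> real \<Rightarrow> real^('v \<times> 'n) \<Rightarrow> real" where
  "penalty f W \<beta> x = aggregate f x + 1 / (2 * \<beta>) * (x \<bullet> (laplacian W *v x))"

subsection \<open>Minimising \<open>F x\<close> subject to \<open>A *v x = 0\<close>\<close>

definition lagrangian ::
  "(real^'k \<Rightarrow> real) \<Rightarrow> real^'k^'k \<Rightarrow> real^'k \<Rightarrow> real^'k \<Rightarrow> real" where
  "lagrangian F A x v = F x + v \<bullet> (A *v x)"

definition sufficient_second_order :: "(real^'k \<Rightarrow> real) \<Rightarrow> real^'k^'k \<Rightarrow> real^'k \<Rightarrow> bool" where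
  "sufficient_second_order F A x \<longleftrightarrow> A *v x = 0 \<and>
     (\<exists>v. gradient F x + A *v v = 0 \<and>
       (\<forall>u. u \<noteq> 0 \<and> A *v u = 0 \<longrightarrow> 0 < u \<bullet> (hessian (\<lambda>y. lagrangian F A y v) x *v u)))"

end

theory Submission
  imports Defs
begin

text \<open>
  Write \<open>A\<close> for the Laplacian \<open>I - W \<otimes> I\<close> and \<open>G\<close> for the gradient of the aggregate objective. The
  gradient of the penalty function is \<open>G x + A x / \<beta>\<close>, and the hypotheses say that it tends to \<open>0\<close>
  along the sequence. On a convergent subsequence \<open>G\<close> stays bounded, so multiplication by \<open>\<beta> \<rightarrow> 0\<close>
  gives \<open>A xbar = 0\<close>, while \<open>A (x / \<beta>)\<close> converges to \<open>- G xbar\<close>. The range of \<open>A\<close> is closed, and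
  therefore \<open>- G xbar = A y\<close> for some \<open>y\<close> (\<open>quadratic_penalty_limit\<close>). The scaled iterates
  \<open>x / \<beta>\<close> themselves may be unbounded, because \<open>A\<close> is singular; closedness of the range takes the
  place of the constraint qualification that usually provides the multiplier.

  The constraint is stated with the square root \<open>B\<close> of \<open>A\<close>. From \<open>B\<^sup>2 = A\<close> and the symmetry of \<open>B\<close>
  it follows that \<open>B\<close> has the same kernel as \<open>A\<close>, so \<open>xbar\<close> is feasible, and that \<open>v = B y\<close> satisfies
  \<open>G xbar + B v = 0\<close>. The constant \<^const>\<open>psd_sqrt\<close> is a definite description, so it has these
  properties only once existence and uniqueness of the root are known; both follow from an
  orthonormal eigenbasis (\<open>symmetric_matrix_orthonormal_eigenbasis\<close>), and \<open>A\<close> is positive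
  semidefinite because \<open>W\<close> is symmetric and doubly stochastic (\<open>pos_semidef_laplacian\<close>).

  For the second order condition, the linear constraint contributes nothing to the Hessian of the
  Lagrangian, and the Hessian of the aggregate objective is block diagonal with positive definite
  blocks (\<open>hessian_aggregate_pos\<close>).
\<close>

section \<open>Spectral theorem for symmetric matrices\<close>

lemma symmetric_matrix_inner:
  fixes A :: "real^'k^'k"
  assumes "transpose A = A"
  shows "(A *v x) \<bullet> y = x \<bullet> (A *v y)"
  by (metis assms dot_lmul_matrix vector_transpose_matrix)

text \<open>A nonnegative quadratic polynomial that vanishes at \<open>0\<close> has a critical point there. This replaces
  differentiation along curves on the sphere in the variational characterisation of eigenvectors.\<close>

lemma nonneg_quadratic_imp_linear_coeff_zero:
  fixes b c :: real
  assumes "\<And>t. 0 \<le> 2 * t * b + t\<^sup>2 * c"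
  shows "b = 0"
proof (rule ccontr)
  assume b: "b \<noteq> 0"
  define d where "d = \<bar>c\<bar> + 1"
  have d: "d > 0" "c \<le> d" by (auto simp: d_def)
  \<comment> \<open>Minimise the quadratic with \<open>c\<close> replaced by the positive upper bound \<open>d\<close>.\<close>
  have "0 \<le> 2 * (- b / d) * b + (- b / d)\<^sup>2 * c" by (rule assms)
  also have "\<dots> \<le> 2 * (- b / d) * b + (- b / d)\<^sup>2 * d"
    using d by (intro add_left_mono mult_left_mono) auto
  also have "\<dots> = - (b\<^sup>2 / d)"
    using d by (simp add: power2_eq_square field_simps)
  also have "\<dots> < 0" using b d by simp
  finally show False by simp
qed

text \<open>A maximiser \<open>e\<close> of the quadratic form on the unit sphere of an invariant subspace is an
  eigenvector, with the maximum \<open>l\<close> as its eigenvalue. On that subspace the form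
  \<open>q x = l * (x \<bullet> x) - x \<bullet> (A *v x)\<close> is nonnegative and vanishes at \<open>e\<close>, so its linear part at \<open>e\<close>
  vanishes in every direction of the subspace, in particular in the direction of the residual
  \<open>l *\<^sub>R e - A *v e\<close>; this makes the residual orthogonal to itself.\<close>

lemma symmetric_matrix_eigenvector_in_subspace:
  fixes A :: "real^'k^'k"
  assumes sym: "transpose A = A" and S: "subspace S"
    and inv: "\<And>x. x \<in> S \<Longrightarrow> A *v x \<in> S"
    and nz: "w \<in> S" "w \<noteq> 0"
  obtains e l where "e \<in> S" "norm e = 1" "A *v e = l *\<^sub>R e"
proof -
  let ?K = "sphere 0 1 \<inter> S"
  have "compact ?K" using S by (intro compact_Int_closed closed_subspace) auto
  moreover have "w /\<^sub>R norm w \<in> ?K"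
    using nz S by (simp add: subspace_scale)
  moreover have "continuous_on ?K (\<lambda>x. x \<bullet> (A *v x))"
    by (intro continuous_intros matrix_vector_mult_linear_continuous_on)
  ultimately obtain e where e: "e \<in> ?K" and max: "\<And>y. y \<in> ?K \<Longrightarrow> y \<bullet> (A *v y) \<le> e \<bullet> (A *v e)"
    using continuous_attains_sup[of ?K "\<lambda>x. x \<bullet> (A *v x)"] by blast
  define l where "l = e \<bullet> (A *v e)"
  define q where "q x = l * (x \<bullet> x) - x \<bullet> (A *v x)" for x
  have q_nonneg: "0 \<le> q x" if "x \<in> S" for x
  proof (cases "x = 0")
    case False
    then have "(x /\<^sub>R norm x) \<bullet> (A *v (x /\<^sub>R norm x)) \<le> l"
      unfolding l_def using that S by (intro max) (simp add: subspace_scale)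
    then have "x \<bullet> (A *v x) / (norm x)\<^sup>2 \<le> l"
      by (simp add: matrix_vector_mult_scaleR power2_eq_square divide_inverse mult_ac)
    then show ?thesis
      using False by (simp add: q_def dot_square_norm field_simps)
  qed (simp add: q_def)
  define r where "r = l *\<^sub>R e - A *v e"
  have ee: "e \<bullet> e = 1" using e by (simp add: dot_square_norm)
  have rS: "r \<in> S" using e S inv by (auto simp: r_def intro!: subspace_diff subspace_scale)
  have "0 \<le> 2 * t * (r \<bullet> r) + t\<^sup>2 * q r" for t
  proof -
    have "0 \<le> q (e + t *\<^sub>R r)"
      using q_nonneg e rS S by (auto intro!: subspace_add subspace_scale)
    also have "\<dots> = q e + 2 * t * (l * (e \<bullet> r) - r \<bullet> (A *v e)) + t\<^sup>2 * q r"
      using symmetric_matrix_inner[OF sym, of e r]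
      by (simp add: q_def algebra_simps inner_add_left inner_add_right power2_eq_square inner_commute)
    also have "q e = 0" by (simp add: q_def l_def ee)
    also have "l * (e \<bullet> r) - r \<bullet> (A *v e) = r \<bullet> r"
      by (subst (4) r_def) (simp add: inner_diff_right inner_commute)
    finally show ?thesis by simp
  qed
  then have "r \<bullet> r = 0" by (rule nonneg_quadratic_imp_linear_coeff_zero)
  then have "A *v e = l *\<^sub>R e" by (simp add: r_def)
  with e show ?thesis by (intro that[of e l]) auto
qed

text \<open>An orthonormal set of eigenvectors of maximal cardinality spans the space: its orthogonal
  complement is invariant under the symmetric matrix, and if it were nonzero it would contain a
  further unit eigenvector. Maximality takes the place of an induction on the dimension.\<close>

theorem symmetric_matrix_orthonormal_eigenbasis:
  fixes A :: "real^'k^'k"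
  assumes sym: "transpose A = A"
  obtains X l where "finite X" "pairwise orthogonal X" "\<And>e. e \<in> X \<Longrightarrow> norm e = 1"
    "\<And>e. e \<in> X \<Longrightarrow> A *v e = l e *\<^sub>R e" "span X = UNIV"
proof -
  define P where "P X \<longleftrightarrow> pairwise orthogonal X \<and> (\<forall>e\<in>X. norm e = 1 \<and> (\<exists>l. A *v e = l *\<^sub>R e))"
    for X
  have bound: "finite X \<and> card X \<le> CARD('k)" if "P X" for X
    using pairwise_orthogonal_independent[of X] independent_bound[of X] that
    by (force simp: P_def)
  have "P {}" by (simp add: P_def)
  moreover have "\<forall>X. P X \<longrightarrow> card X < CARD('k) + 1" using bound by (simp add: less_Suc_eq_le)
  ultimately obtain X where X: "P X" and max: "\<And>Y. P Y \<Longrightarrow> card Y \<le> card X"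
    using ex_has_greatest_nat[of P "{}" card "CARD('k) + 1"] by metis
  have fin: "finite X" using bound X by blast
  obtain l where l: "\<And>e. e \<in> X \<Longrightarrow> A *v e = l e *\<^sub>R e"
    using X unfolding P_def by metis
  have "span X = UNIV"
  proof (rule ccontr)
    assume "span X \<noteq> UNIV"
    then obtain w where w: "w \<noteq> 0" "\<And>y. y \<in> span X \<Longrightarrow> orthogonal w y"
      using orthogonal_to_subspace_exists_gen[of X UNIV] by auto
    define S where "S = {x. \<forall>e\<in>X. x \<bullet> e = 0}"
    have "subspace S" by (auto simp: S_def subspace_def inner_add_left)
    moreover have "A *v x \<in> S" if "x \<in> S" for x
      using that by (simp add: S_def symmetric_matrix_inner[OF sym] l)
    moreover have "w \<in> S" using w(2) by (auto simp: S_def orthogonal_def span_base)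
    ultimately obtain e k where e: "e \<in> S" "norm e = 1" "A *v e = k *\<^sub>R e"
      using symmetric_matrix_eigenvector_in_subspace[OF sym] w(1) by metis
    have "e \<notin> X"
    proof
      assume "e \<in> X"
      then have "e \<bullet> e = 0" using e(1) by (auto simp: S_def)
      with e(2) show False by simp
    qed
    moreover have "P (insert e X)"
      using X e by (auto simp: P_def S_def pairwise_insert orthogonal_def inner_commute)
    ultimately show False using max[of "insert e X"] fin by simp
  qed
  with X l fin show ?thesis by (intro that[of X l]) (auto simp: P_def)
qed

section \<open>The positive semidefinite square root\<close>

lemma matrix_eq_on_spanning_set:
  fixes A B :: "real^'m^'k"
  assumes "span X = UNIV" and "\<And>e. e \<in> X \<Longrightarrow> A *v e = B *v e"
  shows "A = B"
  using linear_eq_on_span[of "(*v) A" "(*v) B" X] assms by (auto simp: matrix_eq)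

lemma psd_sqrt_exists:
  fixes A :: "real^'k^'k"
  assumes A: "pos_semidef A"
  shows "\<exists>B. pos_semidef B \<and> B ** B = A"
proof -
  have sym: "transpose A = A" using A by (simp add: pos_semidef_def)
  obtain X l where X: "finite X" "pairwise orthogonal X" "\<And>e. e \<in> X \<Longrightarrow> norm e = 1"
    "\<And>e. e \<in> X \<Longrightarrow> A *v e = l e *\<^sub>R e" "span X = UNIV"
    using symmetric_matrix_orthonormal_eigenbasis[OF sym] by metis
  have l_nonneg: "0 \<le> l e" if "e \<in> X" for e
  proof -
    have "0 \<le> e \<bullet> (A *v e)" using A by (simp add: pos_semidef_def)
    then show ?thesis using X(3,4)[OF that] by (simp add: dot_square_norm)
  qed
  define T where "T x = (\<Sum>e\<in>X. (sqrt (l e) * (x \<bullet> e)) *\<^sub>R e)" for x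
  have lin: "linear T"
    by (rule linearI) (auto simp: T_def inner_add_left algebra_simps sum.distrib scaleR_sum_right)
  define B where "B = matrix T"
  have B: "B *v x = T x" for x
    using lin by (simp add: B_def matrix_works)
  have T_inner: "T x \<bullet> y = (\<Sum>e\<in>X. sqrt (l e) * (x \<bullet> e) * (y \<bullet> e))" for x y
    by (simp add: T_def inner_sum_left) (simp add: inner_commute)
  have "(B *v x) \<bullet> y = x \<bullet> (B *v y)" for x y
    by (simp add: B T_inner inner_commute[of x "T y"] mult_ac)
  then have "transpose B = B"
    by (metis adjoint_matrix adjoint_unique matrix_of_matrix_vector_mul)
  moreover have "0 \<le> x \<bullet> (B *v x)" for x
    unfolding B inner_commute[of x] T_inner
    by (intro sum_nonneg) (simp add: l_nonneg mult.assoc)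
  ultimately have "pos_semidef B" by (simp add: pos_semidef_def)
  moreover have "B ** B = A"
  proof (rule matrix_eq_on_spanning_set[OF X(5)])
    fix e assume e: "e \<in> X"
    have "T e = (\<Sum>e'\<in>X. if e' = e then sqrt (l e) *\<^sub>R e else 0)"
      unfolding T_def using X(2,3) e
      by (intro sum.cong) (auto simp: pairwise_def orthogonal_def dot_square_norm)
    then have Te: "T e = sqrt (l e) *\<^sub>R e" using X(1) e by simp
    have "(B ** B) *v e = T (T e)" by (simp add: B flip: matrix_vector_mul_assoc)
    also have "\<dots> = l e *\<^sub>R e"
      using l_nonneg[OF e] by (simp add: Te linear_scale[OF lin])
    finally show "(B ** B) *v e = A *v e" using X(4) e by simp
  qed
  ultimately show ?thesis by blast
qed

text \<open>The equation \<open>B\<^sup>2 e = l e\<close> factors as \<open>(B + \<surd>l) (B - \<surd>l) e = 0\<close>. For \<open>l > 0\<close> the first factor is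
  positive definite, hence injective. For \<open>l = 0\<close> the squared norm of \<open>B e\<close> is \<open>e \<bullet> B\<^sup>2 e = 0\<close>.\<close>

lemma psd_root_eigenvector:
  fixes B :: "real^'k^'k"
  assumes B: "pos_semidef B" and eig: "B *v (B *v e) = l *\<^sub>R e" and l: "0 \<le> l"
  shows "B *v e = sqrt l *\<^sub>R e"
proof -
  define w where "w = B *v e - sqrt l *\<^sub>R e"
  have "B *v w + sqrt l *\<^sub>R w = 0"
    using eig l by (simp add: w_def matrix_vector_mult_diff_distrib matrix_vector_mult_scaleR
        algebra_simps)
  then have "w \<bullet> (B *v w) + sqrt l * (w \<bullet> w) = 0"
    by (metis inner_add_right inner_scaleR_right inner_zero_right)
  moreover have "0 \<le> w \<bullet> (B *v w)" "0 \<le> sqrt l * (w \<bullet> w)"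
    using B l by (auto simp: pos_semidef_def)
  ultimately have *: "sqrt l * (w \<bullet> w) = 0" by linarith
  show ?thesis
  proof (cases "l = 0")
    case True
    have "(B *v e) \<bullet> (B *v e) = e \<bullet> (B *v (B *v e))"
      using B by (simp add: pos_semidef_def symmetric_matrix_inner)
    then show ?thesis using eig True by simp
  next
    case False
    then show ?thesis using * by (simp add: w_def)
  qed
qed

text \<open>Every positive semidefinite root acts on an eigenbasis of \<open>A\<close> by the square roots of the
  eigenvalues, so two roots agree on a spanning set.\<close>

lemma psd_sqrt_unique:
  fixes A B C :: "real^'k^'k"
  assumes A: "pos_semidef A" and B: "pos_semidef B" "B ** B = A" and C: "pos_semidef C" "C ** C = A"
  shows "B = C"
proof -
  have sym: "transpose A = A" using A by (simp add: pos_semidef_def)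
  obtain X l where X: "\<And>e. e \<in> X \<Longrightarrow> norm e = 1"
    "\<And>e. e \<in> X \<Longrightarrow> A *v e = l e *\<^sub>R e" "span X = UNIV"
    using symmetric_matrix_orthonormal_eigenbasis[OF sym] by metis
  have "R *v e = sqrt (l e) *\<^sub>R e" if "e \<in> X" "pos_semidef R" "R ** R = A" for e R
  proof (rule psd_root_eigenvector[OF that(2)])
    show "R *v (R *v e) = l e *\<^sub>R e"
      using X(2) that by (simp add: matrix_vector_mul_assoc)
    have "0 \<le> e \<bullet> (A *v e)" using A by (simp add: pos_semidef_def)
    then show "0 \<le> l e" using X(1,2) that(1) by (simp add: dot_square_norm)
  qed
  then show ?thesis
    using B C by (intro matrix_eq_on_spanning_set[OF X(3)]) simp
qed

theorem psd_sqrt_is_root: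
  fixes A :: "real^'k^'k"
  assumes "pos_semidef A"
  shows "pos_semidef (psd_sqrt A) \<and> psd_sqrt A ** psd_sqrt A = A"
  unfolding psd_sqrt_def
proof (rule theI', rule ex_ex1I)
  show "\<exists>B. pos_semidef B \<and> B ** B = A"
    by (rule psd_sqrt_exists[OF assms])
  show "B = C" if "pos_semidef B \<and> B ** B = A" "pos_semidef C \<and> C ** C = A" for B C
    using psd_sqrt_unique[OF assms] that by simp
qed

text \<open>Because \<open>\<parallel>\<surd>A x\<parallel>\<^sup>2 = x \<bullet> A x\<close>.\<close>

lemma psd_sqrt_kernel:
  fixes A :: "real^'k^'k"
  assumes "pos_semidef A"
  shows "psd_sqrt A *v x = 0 \<longleftrightarrow> A *v x = 0"
proof
  let ?B = "psd_sqrt A"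
  have B: "transpose ?B = ?B" "?B *v (?B *v y) = A *v y" for y
    using psd_sqrt_is_root[OF assms] by (auto simp: pos_semidef_def matrix_vector_mul_assoc)
  show "A *v x = 0" if "?B *v x = 0" using B(2)[of x] that by simp
  assume "A *v x = 0"
  then have "(?B *v x) \<bullet> (?B *v x) = 0"
    by (simp add: symmetric_matrix_inner[OF B(1)] B(2))
  then show "?B *v x = 0" by simp
qed

section \<open>Gradients and Hessians\<close>

lemma gradient_eqI:
  assumes "GDERIV f x :> D"
  shows "gradient f x = D"
  unfolding gradient_def
proof (rule the_equality[where P = "\<lambda>D. GDERIV f x :> D", OF assms])
  fix D' assume "GDERIV f x :> D'"
  with assms have "(\<lambda>h. h \<bullet> D') = (\<lambda>h. h \<bullet> D)"
    unfolding gderiv_def by (rule has_derivative_unique[rotated])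
  then have "\<forall>h. h \<bullet> D' = h \<bullet> D" by (simp add: fun_eq_iff)
  then show "D' = D" by (simp only: vector_eq_ldot)
qed

lemma differentiable_imp_GDERIV_gradient:
  fixes f :: "'a::euclidean_space \<Rightarrow> real"
  assumes "f differentiable (at x)"
  shows "GDERIV f x :> gradient f x"
proof -
  obtain f' where f': "(f has_derivative f') (at x)"
    using assms by (auto simp: differentiable_def)
  have "f' h = h \<bullet> adjoint f' 1" for h
    using adjoint_works[OF has_derivative_linear[OF f'], of h 1] by simp
  then have "f' = (\<lambda>h. h \<bullet> adjoint f' 1)" by (rule ext)
  then have "GDERIV f x :> adjoint f' 1"
    using f' by (metis gderiv_def)
  then show ?thesis by (simp add: gradient_eqI)
qed

lemma hessian_eqI:
  assumes "(gradient f has_derivative (\<lambda>h. H *v h)) (at x)"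
  shows "hessian f x = H"
proof -
  have "frechet_derivative (gradient f) (at x) = (\<lambda>h. H *v h)"
    using frechet_derivative_at[OF assms] by (rule sym)
  then show ?thesis
    unfolding hessian_def jacobian_def by simp
qed

lemma has_derivative_gradient_hessian:
  assumes "gradient f differentiable (at x)"
  shows "(gradient f has_derivative (\<lambda>h. hessian f x *v h)) (at x)"
  using assms unfolding hessian_def jacobian_works .

text \<open>The symmetry of \<open>A\<close> moves it from the variable to the multiplier.\<close>

lemma GDERIV_lagrangian:
  assumes F: "GDERIV F y :> D" and A: "transpose A = A"
  shows "GDERIV (\<lambda>y. lagrangian F A y v) y :> D + A *v v"
proof -
  have "((\<lambda>y. v \<bullet> (A *v y)) has_derivative (\<lambda>h. v \<bullet> (A *v h))) (at y)"
    by (intro has_derivative_inner_right bounded_linear_imp_has_derivative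
        matrix_vector_mul_bounded_linear)
  moreover have "v \<bullet> (A *v h) = h \<bullet> (A *v v)" for h
    using symmetric_matrix_inner[OF A, of v h] by (simp only: inner_commute)
  ultimately have "((\<lambda>y. v \<bullet> (A *v y)) has_derivative (\<lambda>h. h \<bullet> (A *v v))) (at y)"
    by simp
  from has_derivative_add[OF F[unfolded gderiv_def] this] show ?thesis
    unfolding gderiv_def lagrangian_def inner_add_right .
qed

text \<open>The constraint is linear, so it only shifts the gradient by a constant. The second order
  condition on the Lagrangian is therefore one on \<open>F\<close> alone, whatever the multiplier.\<close>

lemma hessian_lagrangian:
  fixes F :: "real^'k \<Rightarrow> real"
  assumes F: "\<And>y. F differentiable (at y)" and F2: "gradient F differentiable (at x)"
    and A: "transpose A = A"
  shows "hessian (\<lambda>y. lagrangian F A y v) x = hessian F x"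
proof (rule hessian_eqI)
  have "gradient (\<lambda>y. lagrangian F A y v) = (\<lambda>y. gradient F y + A *v v)"
    by (intro ext gradient_eqI GDERIV_lagrangian differentiable_imp_GDERIV_gradient F A)
  then show "(gradient (\<lambda>y. lagrangian F A y v) has_derivative (\<lambda>h. hessian F x *v h)) (at x)"
    using has_derivative_add[OF has_derivative_gradient_hessian[OF F2] has_derivative_const[of "A *v v"]]
    by simp
qed

section \<open>Stacked vectors and the aggregate objective\<close>

definition stack :: "('v::finite \<Rightarrow> real^'n) \<Rightarrow> real^('v \<times> 'n)" where
  "stack g = (\<chi> p. g (fst p) $ snd p)"

lemma block_stack [simp]: "block i (stack g) = g i"
  by (simp add: block_def stack_def vec_eq_iff)

lemma linear_block: "linear (block i)"
  by (rule linearI) (auto simp: block_def vec_eq_iff)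

lemma sum_UNIV_prod:
  fixes g :: "'v::finite \<times> 'n::finite \<Rightarrow> 'a::comm_monoid_add"
  shows "(\<Sum>p\<in>UNIV. g p) = (\<Sum>i\<in>UNIV. \<Sum>j\<in>UNIV. g (i, j))"
  unfolding sum.cartesian_product UNIV_Times_UNIV by simp

lemma inner_eq_sum_blocks:
  fixes x y :: "real^('v::finite \<times> 'n::finite)"
  shows "x \<bullet> y = (\<Sum>i\<in>UNIV. block i x \<bullet> block i y)"
  by (simp add: inner_vec_def block_def sum_UNIV_prod)

lemma has_derivative_block:
  assumes "(g has_derivative g') (at (block i x))"
  shows "((\<lambda>x. g (block i x)) has_derivative (\<lambda>h. g' (block i h))) (at x)"
proof -
  have "(block i has_derivative block i) (at x)"
    by (intro bounded_linear_imp_has_derivative linear_block[THEN linear_conv_bounded_linear[THEN iffD1]])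
  then show ?thesis using assms by (rule has_derivative_compose)
qed

lemma GDERIV_aggregate:
  fixes f :: "'v::finite \<Rightarrow> real^'n \<Rightarrow> real"
  assumes "\<And>i. f i differentiable (at (block i x))"
  shows "GDERIV (aggregate f) x :> stack (\<lambda>i. gradient (f i) (block i x))"
proof -
  have "((\<lambda>x. f i (block i x)) has_derivative
      (\<lambda>h. block i h \<bullet> gradient (f i) (block i x))) (at x)" for i
    using differentiable_imp_GDERIV_gradient[OF assms] unfolding gderiv_def
    by (rule has_derivative_block)
  then have "((\<lambda>x. \<Sum>i\<in>UNIV. f i (block i x)) has_derivative
      (\<lambda>h. \<Sum>i\<in>UNIV. block i h \<bullet> gradient (f i) (block i x))) (at x)"
    by (rule has_derivative_sum)
  then show ?thesis
    by (simp add: gderiv_def aggregate_def[abs_def] inner_eq_sum_blocks)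
qed

text \<open>The aggregate objective is separable, so its gradient is formed blockwise and the Hessian is
  block diagonal. The linear map on the right is that block diagonal matrix in operator form.\<close>

lemma gradient_aggregate_has_derivative:
  fixes f :: "'v::finite \<Rightarrow> real^'n \<Rightarrow> real"
  assumes f: "\<And>i y. f i differentiable (at y)"
    and f2: "\<And>i y. gradient (f i) differentiable (at y)"
  shows "(gradient (aggregate f) has_derivative
           (\<lambda>h. stack (\<lambda>i. hessian (f i) (block i x) *v block i h))) (at x)"
proof -
  have "gradient (aggregate f) = (\<lambda>x. stack (\<lambda>i. gradient (f i) (block i x)))"
    by (intro ext gradient_eqI GDERIV_aggregate f)
  moreover have "((\<lambda>x. gradient (f i) (block i x) $ j) has_derivative
      (\<lambda>h. (hessian (f i) (block i x) *v block i h) $ j)) (at x)" for i j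
    by (intro bounded_linear.has_derivative[OF bounded_linear_vec_nth] has_derivative_block
        has_derivative_gradient_hessian f2)
  ultimately show ?thesis
    by (subst has_derivative_componentwise_within)
       (auto simp: Basis_vec_def inner_axis stack_def)
qed

lemma inner_hessian_aggregate:
  fixes f :: "'v::finite \<Rightarrow> real^'n \<Rightarrow> real"
  assumes f: "\<And>i y. f i differentiable (at y)"
    and f2: "\<And>i y. gradient (f i) differentiable (at y)"
  shows "u \<bullet> (hessian (aggregate f) x *v u)
           = (\<Sum>i\<in>UNIV. block i u \<bullet> (hessian (f i) (block i x) *v block i u))"
proof -
  define T where "T h = stack (\<lambda>i. hessian (f i) (block i x) *v block i h)" for h
  have D: "(gradient (aggregate f) has_derivative T) (at x)"
    unfolding T_def by (rule gradient_aggregate_has_derivative[OF f f2])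
  have T: "matrix T *v h = T h" for h
    using has_derivative_linear[OF D] by (simp add: matrix_works)
  have "hessian (aggregate f) x = matrix T"
    by (rule hessian_eqI) (simp only: T D)
  then have "hessian (aggregate f) x *v u = T u" by (simp only: T)
  then show ?thesis
    by (simp add: T_def inner_eq_sum_blocks[of u])
qed

lemma regular_objectives_imp_hessian_pos:
  assumes "regular_objectives \<mu> M L f" "0 < \<mu>" "v \<noteq> 0"
  shows "0 < v \<bullet> (hessian (f i) y *v v)"
proof -
  have "0 < v \<bullet> ((hessian (f i) y - \<mu> *\<^sub>R mat 1) *v v)"
    using assms by (auto simp: regular_objectives_def pos_def_def)
  moreover have "0 < \<mu> * (v \<bullet> v)" using assms by simp
  moreover have "(\<mu> *\<^sub>R mat 1) *v v = \<mu> *\<^sub>R v"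
    by (simp flip: scaleR_matrix_vector_assoc)
  ultimately show ?thesis
    by (simp add: matrix_vector_mult_diff_rdistrib inner_diff_right)
qed

text \<open>Each diagonal block is positive definite, and a nonzero \<open>u\<close> has a nonzero block. Positivity holds
  in all directions, not only in those tangent to the constraint.\<close>

lemma hessian_aggregate_pos:
  fixes f :: "'v::finite \<Rightarrow> real^'n \<Rightarrow> real"
  assumes f: "regular_objectives \<mu> M L f" and \<mu>: "0 < \<mu>" and u: "u \<noteq> 0"
  shows "0 < u \<bullet> (hessian (aggregate f) x *v u)"
proof -
  have "\<exists>i. block i u \<noteq> 0"
    using u by (auto simp: block_def vec_eq_iff)
  then obtain k where k: "block k u \<noteq> 0" by blast
  have "0 < (\<Sum>i\<in>UNIV. block i u \<bullet> (hessian (f i) (block i x) *v block i u))"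
  proof (rule sum_pos2[of UNIV k])
    show "0 \<le> block i u \<bullet> (hessian (f i) (block i x) *v block i u)" for i
      using regular_objectives_imp_hessian_pos[OF f \<mu>] by (cases "block i u = 0") (auto intro: less_imp_le)
  qed (use regular_objectives_imp_hessian_pos[OF f \<mu> k] in auto)
  then show ?thesis
    using f by (subst inner_hessian_aggregate)
      (auto simp: regular_objectives_def twice_cont_differentiable_def)
qed

section \<open>The Laplacian and the penalty function\<close>

lemma block_laplacian_mult:
  fixes x :: "real^('v::finite \<times> 'n::finite)"
  shows "block i (laplacian W *v x) = block i x - (\<Sum>j\<in>UNIV. W $ i $ j *\<^sub>R block j x)"
proof -
  have "block i (kronecker W (mat 1) *v x) = (\<Sum>j\<in>UNIV. W $ i $ j *\<^sub>R block j x)"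
  proof -
    have "(\<Sum>k\<in>UNIV. W $ i $ j * (mat 1 :: real^'n^'n) $ c $ k * x $ (j, k)) = W $ i $ j * x $ (j, c)" for j c
    proof -
      have "(\<Sum>k\<in>UNIV. W $ i $ j * (mat 1 :: real^'n^'n) $ c $ k * x $ (j, k))
          = (\<Sum>k\<in>UNIV. if c = k then W $ i $ j * x $ (j, k) else 0)"
        by (intro sum.cong) (auto simp: mat_def)
      then show ?thesis by simp
    qed
    then show ?thesis
      by (simp add: vec_eq_iff block_def kronecker_def matrix_vector_mult_def sum_UNIV_prod)
  qed
  then show ?thesis
    by (simp add: laplacian_def matrix_vector_mult_diff_rdistrib linear_diff[OF linear_block])
qed

text \<open>With \<open>x\<^sub>i\<close> the blocks of \<open>x\<close>, the quadratic form is \<open>\<Sum>\<^sub>i \<parallel>x\<^sub>i\<parallel>\<^sup>2 - \<Sum>\<^sub>i\<^sub>j W\<^sub>i\<^sub>j (x\<^sub>i \<bullet> x\<^sub>j)\<close>. It is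
  nonnegative since \<open>2 (x\<^sub>i \<bullet> x\<^sub>j) \<le> \<parallel>x\<^sub>i\<parallel>\<^sup>2 + \<parallel>x\<^sub>j\<parallel>\<^sup>2\<close> and the weights are nonnegative and sum to
  \<open>1\<close> in every row and column.\<close>

lemma pos_semidef_laplacian:
  assumes sym: "transpose W = W" and W: "doubly_stochastic W"
  shows "pos_semidef (laplacian W :: real^('v \<times> 'n)^('v::finite \<times> 'n::finite))"
proof -
  let ?L = "laplacian W :: real^('v \<times> 'n)^('v \<times> 'n)"
  have rows: "(\<Sum>j\<in>UNIV. W $ i $ j) = 1" and cols: "(\<Sum>i\<in>UNIV. W $ i $ j) = 1" for i j
    using W by (auto simp: doubly_stochastic_def)
  have "W $ i $ j = W $ j $ i" for i j
    by (metis sym transpose_def vec_lambda_beta)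
  then have "transpose ?L = ?L"
    by (auto simp: vec_eq_iff transpose_def laplacian_def kronecker_def mat_def)
  moreover have "0 \<le> x \<bullet> (?L *v x)" for x :: "real^('v \<times> 'n)"
  proof -
    let ?b = "\<lambda>i. block i x"
    have "(\<Sum>i\<in>UNIV. \<Sum>j\<in>UNIV. W $ i $ j * (?b i \<bullet> ?b j))
        \<le> (\<Sum>i\<in>UNIV. \<Sum>j\<in>UNIV. W $ i $ j * ((?b i \<bullet> ?b i + ?b j \<bullet> ?b j) / 2))"
    proof (intro sum_mono mult_left_mono)
      fix i j :: 'v
      have "0 \<le> (?b i - ?b j) \<bullet> (?b i - ?b j)" by simp
      then show "?b i \<bullet> ?b j \<le> (?b i \<bullet> ?b i + ?b j \<bullet> ?b j) / 2"
        by (simp add: inner_diff_left inner_diff_right inner_commute)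
      show "0 \<le> W $ i $ j" using W by (simp add: doubly_stochastic_def)
    qed
    also have "\<dots> = (\<Sum>i\<in>UNIV. \<Sum>j\<in>UNIV. W $ i $ j * (?b i \<bullet> ?b i) / 2)
        + (\<Sum>i\<in>UNIV. \<Sum>j\<in>UNIV. W $ i $ j * (?b j \<bullet> ?b j) / 2)"
      by (simp add: distrib_left add_divide_distrib sum.distrib)
    also have "(\<Sum>i\<in>UNIV. \<Sum>j\<in>UNIV. W $ i $ j * (?b j \<bullet> ?b j) / 2)
        = (\<Sum>j\<in>UNIV. \<Sum>i\<in>UNIV. W $ i $ j * (?b j \<bullet> ?b j) / 2)"
      by (rule sum.swap)
    also have "(\<Sum>i\<in>UNIV. \<Sum>j\<in>UNIV. W $ i $ j * (?b i \<bullet> ?b i) / 2) + \<dots>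
        = (\<Sum>i\<in>UNIV. ?b i \<bullet> ?b i / 2) + (\<Sum>j\<in>UNIV. ?b j \<bullet> ?b j / 2)"
      by (simp add: rows cols flip: sum_distrib_right sum_divide_distrib)
    also have "\<dots> = x \<bullet> x"
      by (simp add: inner_eq_sum_blocks[of x] flip: sum_divide_distrib)
    finally show ?thesis
      by (simp add: inner_eq_sum_blocks block_laplacian_mult inner_diff_right inner_sum_right
          sum_subtractf)
  qed
  ultimately show ?thesis by (simp add: pos_semidef_def)
qed

lemma gradient_penalty:
  fixes f :: "'v::finite \<Rightarrow> real^'n \<Rightarrow> real"
  assumes F: "GDERIV (aggregate f) x :> D"
    and W: "transpose (laplacian W) = (laplacian W :: real^('v \<times> 'n)^('v \<times> 'n))"
  shows "gradient (penalty f W \<beta>) x = D + (1 / \<beta>) *\<^sub>R (laplacian W *v x)"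
proof (rule gradient_eqI)
  let ?L = "laplacian W :: real^('v \<times> 'n)^('v \<times> 'n)"
  have "((\<lambda>x. x \<bullet> (?L *v x)) has_derivative (\<lambda>h. x \<bullet> (?L *v h) + h \<bullet> (?L *v x))) (at x)"
    by (intro has_derivative_inner has_derivative_ident bounded_linear_imp_has_derivative
        matrix_vector_mul_bounded_linear)
  also have "(\<lambda>h. x \<bullet> (?L *v h) + h \<bullet> (?L *v x)) = (\<lambda>h. 2 * (h \<bullet> (?L *v x)))"
    using symmetric_matrix_inner[OF W, of x] by (simp add: inner_commute)
  finally have "((\<lambda>x. 1 / (2 * \<beta>) * (x \<bullet> (?L *v x))) has_derivative
      (\<lambda>h. 1 / (2 * \<beta>) * (2 * (h \<bullet> (?L *v x))))) (at x)"
    by (rule has_derivative_mult_right)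
  from has_derivative_add[OF F[unfolded gderiv_def] this]
  show "GDERIV (penalty f W \<beta>) x :> D + (1 / \<beta>) *\<^sub>R (?L *v x)"
    by (simp add: gderiv_def penalty_def[abs_def] inner_add_right)
qed

section \<open>Limits of approximate stationary points\<close>

lemma tendsto_0_if_infnorm_le:
  fixes g :: "nat \<Rightarrow> 'a::euclidean_space"
  assumes le: "\<And>s. infnorm (g s) \<le> e s" and e: "e \<longlonglongrightarrow> 0"
  shows "g \<longlonglongrightarrow> 0"
proof (rule Lim_null_comparison)
  have "norm (g s) \<le> sqrt DIM('a) * e s" for s
    using norm_le_infnorm[of "g s"] mult_left_mono[OF le, of "sqrt DIM('a)" s]
    by (meson order_trans real_sqrt_ge_zero of_nat_0_le_iff)
  then show "\<forall>\<^sub>F s in sequentially. norm (g s) \<le> sqrt DIM('a) * e s"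
    by (rule always_eventually[OF allI])
  show "(\<lambda>s. sqrt DIM('a) * e s) \<longlonglongrightarrow> 0"
    using tendsto_mult_right_zero[OF e] by simp
qed

text \<open>Multiplying the residual by \<open>\<beta> s\<close> isolates \<open>A *v x s\<close> and forces it to \<open>0\<close>; this gives feasibility.
  The scaled iterates \<open>x s / \<beta> s\<close> need not converge, but their images under \<open>A\<close> do, to
  \<open>- g xbar\<close>. The range of \<open>A\<close> is a subspace of a finite-dimensional space, hence closed, so it
  contains this limit.\<close>

lemma quadratic_penalty_limit:
  fixes A :: "real^'k^'k" and g :: "real^'k \<Rightarrow> real^'k"
  assumes x: "x \<longlonglongrightarrow> xbar" and g: "isCont g xbar"
    and \<beta>: "\<beta> \<longlonglongrightarrow> 0" "\<And>s. \<beta> s \<noteq> 0"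
    and stat: "(\<lambda>s. g (x s) + (1 / \<beta> s) *\<^sub>R (A *v x s)) \<longlonglongrightarrow> 0"
  shows "A *v xbar = 0" and "\<exists>y. g xbar + A *v y = 0"
proof -
  let ?r = "\<lambda>s. g (x s) + (1 / \<beta> s) *\<^sub>R (A *v x s)"
  have gx: "(\<lambda>s. g (x s)) \<longlonglongrightarrow> g xbar"
    using g x by (rule isCont_tendsto_compose)
  have "(\<lambda>s. A *v x s) \<longlonglongrightarrow> A *v xbar"
    using x by (intro isCont_tendsto_compose[OF _ x] linear_continuous_at) auto
  moreover have "(\<lambda>s. A *v x s) \<longlonglongrightarrow> 0"
  proof -
    have "(\<lambda>s. \<beta> s *\<^sub>R (?r s - g (x s))) \<longlonglongrightarrow> 0 *\<^sub>R (0 - g xbar)"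
      by (intro tendsto_intros \<beta> stat gx)
    then show ?thesis using \<beta>(2) by simp
  qed
  ultimately show "A *v xbar = 0" by (rule LIMSEQ_unique)
  have "closed (range ((*v) A))"
    by (intro closed_subspace linear_subspace_image) auto
  moreover have "(\<lambda>s. A *v ((1 / \<beta> s) *\<^sub>R x s)) \<longlonglongrightarrow> 0 - g xbar"
    using tendsto_diff[OF stat gx] by (simp add: matrix_vector_mult_scaleR)
  ultimately have "0 - g xbar \<in> range ((*v) A)"
    by (meson closed_sequentially rangeI)
  then obtain y where "- g xbar = A *v y" by auto
  then show "\<exists>y. g xbar + A *v y = 0" by (metis add.right_inverse)
qed

theorem theorem6p1:
  fixes E :: "('v::finite \<times> 'v) set"
    and W :: "real^'v^'v"
    and f :: "'v \<Rightarrow> real^'n \<Rightarrow> real"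
    and \<mu> M L :: real
    and \<beta> \<epsilon> :: "nat \<Rightarrow> real"
    and xhat :: "nat \<Rightarrow> real^('v \<times> 'n)"
    and xbar :: "real^('v \<times> 'n)"
  assumes A1: "connected_network E"
    and A2: "network_weights E W"
    and A3: "0 < \<mu>" "\<mu> < M" "0 < L" "regular_objectives \<mu> M L f"
    and beta_pos: "\<And>s. 0 < \<beta> s"
    and approx: "\<And>s. infnorm (gradient (penalty f W (\<beta> s)) (xhat s)) \<le> \<epsilon> s"
    and beta_lim: "\<beta> \<longlonglongrightarrow> 0"
    and eps_lim: "\<epsilon> \<longlonglongrightarrow> 0"
    and accumulation: "\<exists>r. strict_mono r \<and> (xhat \<circ> r) \<longlonglongrightarrow> xbar"
  shows "sufficient_second_order (aggregate f) (psd_sqrt (laplacian W)) xbar"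
proof -
  let ?A = "laplacian W :: real^('v \<times> 'n)^('v \<times> 'n)"
  let ?B = "psd_sqrt ?A"
  let ?G = "gradient (aggregate f)"
  have f: "f i differentiable (at y)" "gradient (f i) differentiable (at y)" for i y
    using A3(4) by (auto simp: regular_objectives_def twice_cont_differentiable_def)
  have F: "aggregate f differentiable (at y)" for y
    using GDERIV_aggregate[of f y, OF f(1)] unfolding gderiv_def differentiable_def by blast
  have G: "?G differentiable (at y)" for y
    using gradient_aggregate_has_derivative[of f y, OF f] unfolding differentiable_def by blast
  have A: "pos_semidef ?A"
    using A2 by (intro pos_semidef_laplacian) (auto simp: network_weights_def)
  then have A_sym: "transpose ?A = ?A" by (simp add: pos_semidef_def)
  have B: "transpose ?B = ?B" "?B *v (?B *v y) = ?A *v y" for y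
    using psd_sqrt_is_root[OF A] by (auto simp: pos_semidef_def matrix_vector_mul_assoc)
  obtain r where r: "strict_mono r" "(xhat \<circ> r) \<longlonglongrightarrow> xbar"
    using accumulation by blast
  have "(\<lambda>s. ?G (xhat s) + (1 / \<beta> s) *\<^sub>R (?A *v xhat s)) \<longlonglongrightarrow> 0"
    using tendsto_0_if_infnorm_le[OF approx eps_lim]
    by (simp add: gradient_penalty[OF differentiable_imp_GDERIV_gradient[OF F] A_sym])
  then have stat: "(\<lambda>s. ?G ((xhat \<circ> r) s) + (1 / (\<beta> \<circ> r) s) *\<^sub>R (?A *v (xhat \<circ> r) s)) \<longlonglongrightarrow> 0"
    using LIMSEQ_subseq_LIMSEQ[OF _ r(1)] by (fastforce simp: o_def)
  have \<beta>: "(\<beta> \<circ> r) \<longlonglongrightarrow> 0" "(\<beta> \<circ> r) s \<noteq> 0" for s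
    using LIMSEQ_subseq_LIMSEQ[OF beta_lim r(1)] beta_pos[of "r s"] by auto
  note limit = quadratic_penalty_limit[OF r(2) differentiable_imp_continuous_within[OF G] \<beta> stat]
  obtain y where y: "?G xbar + ?A *v y = 0" using limit(2) by blast
  \<comment> \<open>The multiplier is \<open>?B *v y\<close>, because the limit argument yields \<open>- ?G xbar\<close> in the range of
    \<open>?A\<close>, the square of \<open>?B\<close>.\<close>
  have "?B *v xbar = 0" using limit(1) by (simp add: psd_sqrt_kernel[OF A])
  moreover have "?G xbar + ?B *v (?B *v y) = 0" using y by (simp add: B(2))
  moreover have "0 < u \<bullet> (hessian (\<lambda>x. lagrangian (aggregate f) ?B x v) xbar *v u)" if "u \<noteq> 0" for u v
    using hessian_aggregate_pos[OF A3(4,1) that]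
    by (simp add: hessian_lagrangian[OF F G B(1)])
  ultimately show ?thesis
    unfolding sufficient_second_order_def by blast
qed

end
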